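(* Let $A,B,C$ be finite index subgroups of a group $G$. Then $\mathrm{e}(A,C)\,\mathrm{e}(C,B)=\mathrm{e}(A,B)$ if and only if $C$ contains the subgroup $A\cap B$ and $C=(C\cap A)(C\cap B)$.
   Context: For finite index subgroups $A,B$ of a group $G$, $\mathrm{e}(A,B)=[A:A\cap B]\,[B:A\cap B]=\frac{[G:A\cap B]^2}{[G:A][G:B]}$; this is the exponential of the double Ruzsa distance $\mathrm{d}(A,B)$ between $A$ and $B$. The product of subsets $X,Y$ of $G$ is $XY=\{xy:x\in X,y\in Y\}$. *)

theory Defs
  imports "HOL-Algebra.Algebra"
begin

(* Like card, this is 0 if there are infinitely many cosets. *)
definition subgroup_index :: "('a, 'b) monoid_scheme \<Rightarrow> 'a set \<Rightarrow> nat"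
  where "subgroup_index G H = card (rcosets\<^bsub>G\<^esub> H)"

definition finite_index_subgroup :: "'a set \<Rightarrow> ('a, 'b) monoid_scheme \<Rightarrow> bool"
  where "finite_index_subgroup H G \<longleftrightarrow> subgroup H G \<and> finite (rcosets\<^bsub>G\<^esub> H)"

(* e(A,B) = [A : A \<inter> B] [B : A \<inter> B], where A and B are viewed as groups with the
   operation of G.  For A and B of finite index in G both indices are finite. *)
definition exp_double_Ruzsa :: "('a, 'b) monoid_scheme \<Rightarrow> 'a set \<Rightarrow> 'a set \<Rightarrow> nat"
  where "exp_double_Ruzsa G A B =
    subgroup_index (G\<lparr>carrier := A\<rparr>) (A \<inter> B) * subgroup_index (G\<lparr>carrier := B\<rparr>) (A \<inter> B)"

end

theory Submission
  imports Defs
begin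

text \<open>
  Write \<open>i H K = [H : H \<inter> K]\<close>, the number of cosets of \<open>K\<close> that meet \<open>H\<close>. Computing
  \<open>[A : A \<inter> B \<inter> C]\<close> and \<open>[B : A \<inter> B \<inter> C]\<close> along two chains each gives
  \<open>i A B * i B A * n\<^sup>2 = i A C * i (A \<inter> C) B * i B C * i (B \<inter> C) A\<close> with \<open>n = i (A \<inter> B) C\<close>. Since
  \<open>i (A \<inter> C) B \<le> i C B\<close> and \<open>i (B \<inter> C) A \<le> i C A\<close>, this yields
  \<open>e(A,B) \<le> e(A,B) n\<^sup>2 \<le> e(A,C) e(C,B)\<close>. The first inequality is an equality iff \<open>A \<inter> B \<subseteq> C\<close>.
  Equality in \<open>i (B \<inter> C) A \<le> i C A\<close> means that every coset of \<open>A\<close> meeting \<open>C\<close> already meets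
  \<open>B \<inter> C\<close>, i.e. \<open>C = (C \<inter> A)(C \<inter> B)\<close>; equality in \<open>i (A \<inter> C) B \<le> i C B\<close> means
  \<open>C = (C \<inter> B)(C \<inter> A)\<close>, which is the same condition by inversion.
\<close>

text \<open>Counting cosets inside \<open>G\<close> keeps one carrier throughout and does not ask
  for \<open>K \<subseteq> H\<close>, so monotonicity in \<open>H\<close> is just inclusion of
  images.\<close>

definition relative_index :: "('a, 'b) monoid_scheme \<Rightarrow> 'a set \<Rightarrow> 'a set \<Rightarrow> nat"
  where "relative_index G H K = card ((\<lambda>h. K #>\<^bsub>G\<^esub> h) ` H)"

text \<open>Sending \<open>f x\<close> to \<open>g x\<close> is a well-defined bijection between the
  images. Cosets of different subgroups can thus be counted against each other by comparing only
  when two of them coincide.\<close>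

lemma card_image_eq_if_same_kernel:
  assumes "\<And>x y. x \<in> S \<Longrightarrow> y \<in> S \<Longrightarrow> f x = f y \<longleftrightarrow> g x = g y"
  shows "card (f ` S) = card (g ` S)"
proof -
  have "inj_on (\<lambda>z. g (inv_into S f z)) (f ` S)"
    by (rule inj_onI) (metis assms f_inv_into_f inv_into_into)
  moreover have "(\<lambda>z. g (inv_into S f z)) ` f ` S = g ` S"
    unfolding image_image
    by (rule image_cong[OF refl]) (metis assms f_inv_into_f imageI inv_into_into)
  ultimately show ?thesis
    by (metis card_image)
qed

section \<open>Relative indices and the tower law\<close>

context group
begin

lemma r_coset_eq_iff:
  assumes "subgroup K G" "x \<in> carrier G" "y \<in> carrier G"
  shows "K #> x = K #> y \<longleftrightarrow> x \<otimes> inv y \<in> K"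
proof
  assume "K #> x = K #> y"
  then obtain k where "k \<in> K" "x = k \<otimes> y"
    using rcos_self[OF assms(2,1)] unfolding r_coset_def by auto
  with assms show "x \<otimes> inv y \<in> K"
    by (metis inv_solve_right subgroup.mem_carrier)
next
  assume "x \<otimes> inv y \<in> K"
  with assms have "x \<in> K #> y"
    unfolding r_coset_def
    by (auto intro!: bexI[of _ "x \<otimes> inv y"] simp: m_assoc)
  with assms show "K #> x = K #> y"
    by (metis repr_independence)
qed

text \<open>For \<open>x\<close>, \<open>y\<close> in \<open>H\<close> the element
  \<open>x \<otimes> inv y\<close> is in \<open>H\<close> anyway, so it lies in
  \<open>H \<inter> K\<close> exactly when it lies in \<open>K\<close>.\<close>

lemma subgroup_index_eq_relative_index:
  assumes "subgroup H G" "subgroup K G"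
  shows "subgroup_index (G\<lparr>carrier := H\<rparr>) (H \<inter> K) = relative_index G H K"
proof -
  have "rcosets\<^bsub>G\<lparr>carrier := H\<rparr>\<^esub> (H \<inter> K) = (\<lambda>h. (H \<inter> K) #> h) ` H"
    by (auto simp: RCOSETS_def r_coset_def)
  moreover have "(H \<inter> K) #> x = (H \<inter> K) #> y \<longleftrightarrow> K #> x = K #> y" if "x \<in> H" "y \<in> H" for x y
    using that assms subgroups_Inter_pair[OF assms]
    by (auto simp: r_coset_eq_iff subgroup.mem_carrier subgroup.m_closed subgroup.m_inv_closed)
  then have "card ((\<lambda>h. (H \<inter> K) #> h) ` H) = card ((\<lambda>h. K #> h) ` H)"
    by (rule card_image_eq_if_same_kernel)
  ultimately show ?thesis
    by (simp add: subgroup_index_def relative_index_def)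
qed

lemma exp_double_Ruzsa_eq:
  assumes "subgroup A G" "subgroup B G"
  shows "exp_double_Ruzsa G A B = relative_index G A B * relative_index G B A"
  unfolding exp_double_Ruzsa_def subgroup_index_eq_relative_index[OF assms]
  unfolding Int_commute[of A B] subgroup_index_eq_relative_index[OF assms(2,1)] ..

text \<open>This is the tower law for \<open>H \<inter> K \<inter> L \<subseteq> H \<inter> K
  \<subseteq> H\<close>. Writing \<open>h = q h \<otimes> r (K #> h)\<close> with a fixed
  representative of each coset, the coset of \<open>h\<close> modulo \<open>K \<inter> L\<close>
  corresponds to the pair \<open>(K #> h, L #> q h)\<close>.\<close>

lemma relative_index_Int:
  assumes H: "subgroup H G" and K: "subgroup K G" and L: "subgroup L G"
  shows "relative_index G H (K \<inter> L) = relative_index G H K * relative_index G (H \<inter> K) L"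
proof -
  define r where "r = inv_into H (\<lambda>h. K #> h)"
  have r: "r (K #> h) \<in> H" "K #> r (K #> h) = K #> h" if "h \<in> H" for h
    using that inv_into_into[of "K #> h" "\<lambda>h. K #> h" H] f_inv_into_f[of "K #> h" "\<lambda>h. K #> h" H]
    unfolding r_def by blast+
  have Hc: "h \<in> carrier G" if "h \<in> H" for h
    using H that by (rule subgroup.mem_carrier)
  note mem = Hc subgroup.m_closed[OF H] subgroup.m_inv_closed[OF H]
  define q where "q = (\<lambda>h. h \<otimes> inv (r (K #> h)))"
  have q: "q h \<in> H \<inter> K" if "h \<in> H" for h
    using r[OF that] that r_coset_eq_iff[OF K, of h "r (K #> h)"] by (simp add: q_def mem)
  have "(K \<inter> L) #> x = (K \<inter> L) #> y \<longleftrightarrow> (K #> x, L #> q x) = (K #> y, L #> q y)"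
    if xy: "x \<in> H" "y \<in> H" for x y
  proof (cases "K #> x = K #> y")
    case True
    \<comment> \<open>In a common coset of \<open>K\<close> both elements have the same
      representative, which cancels.\<close>
    have "q x \<otimes> inv (q y) = x \<otimes> inv y"
      using xy r(1)[OF xy(2)] unfolding q_def True
      by (simp add: mem inv_mult_group m_assoc inv_solve_left')
    then have "L #> q x = L #> q y \<longleftrightarrow> L #> x = L #> y"
      using xy q L by (simp add: r_coset_eq_iff mem)
    with True show ?thesis
      using xy K L subgroups_Inter_pair[OF K L] by (simp add: r_coset_eq_iff mem)
  next
    case False
    then show ?thesis
      using xy K subgroups_Inter_pair[OF K L] by (simp add: r_coset_eq_iff mem)
  qed
  then have "relative_index G H (K \<inter> L) = card ((\<lambda>h. (K #> h, L #> q h)) ` H)"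
    unfolding relative_index_def by (rule card_image_eq_if_same_kernel)
  also have "(\<lambda>h. (K #> h, L #> q h)) ` H = (\<lambda>h. K #> h) ` H \<times> (\<lambda>h. L #> h) ` (H \<inter> K)"
  proof
    show "(\<lambda>h. (K #> h, L #> q h)) ` H \<subseteq> (\<lambda>h. K #> h) ` H \<times> (\<lambda>h. L #> h) ` (H \<inter> K)"
      using q by blast
    show "(\<lambda>h. K #> h) ` H \<times> (\<lambda>h. L #> h) ` (H \<inter> K) \<subseteq> (\<lambda>h. (K #> h, L #> q h)) ` H"
    proof clarify
      fix h g assume h: "h \<in> H" and g: "g \<in> H" "g \<in> K"
      \<comment> \<open>The factor \<open>g\<close> lies in \<open>K\<close>, so it leaves the coset
        of the representative unchanged and is recovered as \<open>q ?x\<close>.\<close>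
      let ?x = "g \<otimes> r (K #> h)"
      have x: "?x \<in> H"
        using g h r by (simp add: mem)
      have "K #> ?x = K #> r (K #> h)"
        using g h r x by (subst r_coset_eq_iff[OF K]) (simp_all add: mem m_assoc)
      then have Kx: "K #> ?x = K #> h"
        using r h by simp
      then have "q ?x = g"
        using g h r by (simp add: q_def mem m_assoc)
      with Kx x show "(K #> h, L #> g) \<in> (\<lambda>h. (K #> h, L #> q h)) ` H"
        by (metis (mono_tags, lifting) imageI)
    qed
  qed
  finally show ?thesis
    by (simp add: relative_index_def card_cartesian_product)
qed

section \<open>Finiteness, positivity and monotonicity of relative indices\<close>

lemma finite_relative_cosets:
  assumes "subgroup H G" "finite_index_subgroup K G"
  shows "finite ((\<lambda>h. K #> h) ` H)"
proof (rule finite_subset)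
  show "(\<lambda>h. K #> h) ` H \<subseteq> rcosets K"
    using subgroup.subset[OF assms(1)] by (auto simp: RCOSETS_def)
  show "finite (rcosets K)"
    using assms(2) by (simp add: finite_index_subgroup_def)
qed

lemma relative_index_pos:
  assumes "subgroup H G" "finite_index_subgroup K G"
  shows "0 < relative_index G H K"
  using finite_relative_cosets[OF assms] subgroup.one_closed[OF assms(1)]
  by (auto simp: relative_index_def card_gt_0_iff)

lemma relative_index_mono:
  assumes "subgroup H G" "finite_index_subgroup K G" "H' \<subseteq> H"
  shows "relative_index G H' K \<le> relative_index G H K"
  unfolding relative_index_def
  using finite_relative_cosets[OF assms(1,2)] assms(3) by (intro card_mono image_mono)

lemma relative_index_eq_1_iff:
  assumes "subgroup H G" "finite_index_subgroup K G"
  shows "relative_index G H K = 1 \<longleftrightarrow> H \<subseteq> K"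
proof -
  have K: "subgroup K G"
    using assms(2) by (simp add: finite_index_subgroup_def)
  have triv: "K #> h = K #> \<one> \<longleftrightarrow> h \<in> K" if "h \<in> H" for h
    using that subgroup.mem_carrier[OF assms(1)] by (simp add: r_coset_eq_iff[OF K])
  have one: "\<one> \<in> H"
    using assms(1) by (rule subgroup.one_closed)
  show ?thesis
  proof
    assume "relative_index G H K = 1"
    then obtain Z where "(\<lambda>h. K #> h) ` H = {Z}"
      unfolding relative_index_def by (rule card_1_singletonE)
    then have "K #> h = Z" if "h \<in> H" for h
      using that by (auto dest: equalityD1)
    \<comment> \<open>Since \<open>\<one>\<close> is in \<open>H\<close>, the single coset
      \<open>Z\<close> must be that of \<open>\<one>\<close>.\<close>
    then show "H \<subseteq> K"
      using triv one by (metis subsetI)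
  next
    assume "H \<subseteq> K"
    then have "(\<lambda>h. K #> h) ` H = (\<lambda>h. K #> \<one>) ` H"
      using triv by (intro image_cong) auto
    also have "\<dots> = {K #> \<one>}"
      using one by (simp add: image_constant)
    finally have "(\<lambda>h. K #> h) ` H = {K #> \<one>}" .
    then show "relative_index G H K = 1"
      by (simp add: relative_index_def)
  qed
qed

section \<open>Equality of indices as a factorization of \<open>C\<close>\<close>

lemma relative_index_Int_eq_iff:
  assumes C: "subgroup C G" and A: "finite_index_subgroup A G" and B: "subgroup B G"
  shows "relative_index G (B \<inter> C) A = relative_index G C A \<longleftrightarrow> C = (C \<inter> A) <#> (C \<inter> B)"
proof -
  have A': "subgroup A G"
    using A by (simp add: finite_index_subgroup_def)
  note mem = subgroup.mem_carrier[OF C] subgroup.m_closed[OF C] subgroup.m_inv_closed[OF C]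
  have "relative_index G (B \<inter> C) A = relative_index G C A \<longleftrightarrow>
      (\<lambda>h. A #> h) ` (B \<inter> C) = (\<lambda>h. A #> h) ` C"
    \<comment> \<open>One image contains the other and the larger is finite, so equal cardinality
      means equal sets.\<close>
    unfolding relative_index_def
    using card_subset_eq[OF finite_relative_cosets[OF C A], of "(\<lambda>h. A #> h) ` (B \<inter> C)"] by auto
  also have "\<dots> \<longleftrightarrow> (\<forall>c\<in>C. \<exists>b\<in>B \<inter> C. A #> c = A #> b)"
    by blast
  also have "\<dots> \<longleftrightarrow> (\<forall>c\<in>C. \<exists>b\<in>B \<inter> C. c \<otimes> inv b \<in> A)"
    by (simp add: r_coset_eq_iff[OF A'] mem)
  also have "\<dots> \<longleftrightarrow> C \<subseteq> (C \<inter> A) <#> (C \<inter> B)"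
  proof
    assume *: "\<forall>c\<in>C. \<exists>b\<in>B \<inter> C. c \<otimes> inv b \<in> A"
    show "C \<subseteq> (C \<inter> A) <#> (C \<inter> B)"
    proof
      fix c assume c: "c \<in> C"
      with * obtain b where b: "b \<in> B" "b \<in> C" "c \<otimes> inv b \<in> A"
        by blast
      with c have "c = (c \<otimes> inv b) \<otimes> b"
        by (simp add: mem m_assoc)
      with b c show "c \<in> (C \<inter> A) <#> (C \<inter> B)"
        unfolding set_mult_def using mem by blast
    qed
  next
    assume *: "C \<subseteq> (C \<inter> A) <#> (C \<inter> B)"
    show "\<forall>c\<in>C. \<exists>b\<in>B \<inter> C. c \<otimes> inv b \<in> A"
    proof
      fix c assume "c \<in> C"
      with * obtain a b where "a \<in> C" "a \<in> A" "b \<in> C" "b \<in> B" "c = a \<otimes> b"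
        unfolding set_mult_def by blast
      then show "\<exists>b\<in>B \<inter> C. c \<otimes> inv b \<in> A"
        by (auto intro!: bexI[of _ b] simp: mem m_assoc)
    qed
  qed
  \<comment> \<open>The other inclusion always holds, as \<open>C\<close> is closed under
    multiplication.\<close>
  also have "\<dots> \<longleftrightarrow> C = (C \<inter> A) <#> (C \<inter> B)"
    unfolding set_mult_def using mem by blast
  finally show ?thesis .
qed

text \<open>Inversion maps \<open>C\<close> onto itself and reverses products. This reconciles the
  two orders of factors that arise from the equality cases for \<open>A\<close> and for
  \<open>B\<close>.\<close>

lemma eq_set_mult_Int_commute:
  assumes "subgroup A G" "subgroup B G" "subgroup C G"
  shows "C = (C \<inter> A) <#> (C \<inter> B) \<longleftrightarrow> C = (C \<inter> B) <#> (C \<inter> A)"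
proof -
  have "C = (C \<inter> N) <#> (C \<inter> M)"
    if C: "C = (C \<inter> M) <#> (C \<inter> N)" and M: "subgroup M G" and N: "subgroup N G" for M N
  proof
    show "(C \<inter> N) <#> (C \<inter> M) \<subseteq> C"
      unfolding set_mult_def using subgroup.m_closed[OF assms(3)] by blast
    show "C \<subseteq> (C \<inter> N) <#> (C \<inter> M)"
    proof
      fix c assume c: "c \<in> C"
      then have "inv c \<in> (C \<inter> M) <#> (C \<inter> N)"
        using C subgroup.m_inv_closed[OF assms(3)] by blast
      then obtain m n where mn: "m \<in> C" "m \<in> M" "n \<in> C" "n \<in> N" "inv c = m \<otimes> n"
        unfolding set_mult_def by blast
      then have "c = inv n \<otimes> inv m"
        using c subgroup.mem_carrier[OF assms(3)] by (metis inv_inv inv_mult_group)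
      with mn M N assms(3) show "c \<in> (C \<inter> N) <#> (C \<inter> M)"
        unfolding set_mult_def by (blast intro: subgroup.m_inv_closed)
    qed
  qed
  then show ?thesis
    using assms by blast
qed

end

text \<open>The arithmetic of the equality case: \<open>p * q\<close> is e(A,B), \<open>n\<close> is
  the index of \<open>A \<inter> B \<inter> C\<close> in \<open>A \<inter> B\<close>, and
  \<open>u \<le> u'\<close>, \<open>v \<le> v'\<close> are the two monotonicity bounds. Positivity
  allows the common factors to be cancelled.\<close>

lemma product_eq_iff_factors_eq:
  fixes p q s t u v u' v' n :: nat
  assumes "p * q * n\<^sup>2 = s * u * (t * v)" "u \<le> u'" "v \<le> v'"
    and "0 < p" "0 < q" "0 < n" "0 < s" "0 < t" "0 < u" "0 < v"
  shows "s * v' * (u' * t) = p * q \<longleftrightarrow> n = 1 \<and> u = u' \<and> v = v'"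
proof
  assume eq: "s * v' * (u' * t) = p * q"
  have "p * q * n\<^sup>2 = s * t * (u * v)"
    using assms(1) by (simp add: ac_simps)
  also have "\<dots> \<le> s * t * (u' * v')"
    using assms by (intro mult_le_mono) auto
  also have "\<dots> = p * q"
    using eq by (simp add: ac_simps)
  finally have "p * q * n\<^sup>2 \<le> p * q * 1"
    by simp
  then have "n\<^sup>2 \<le> 1"
    using \<open>0 < p\<close> \<open>0 < q\<close> by (subst (asm) mult_le_cancel1) simp
  then have n: "n = 1"
    using \<open>0 < n\<close> power_le_one_iff[of n 2] by simp
  then have "(s * t) * (u * v) = (s * t) * (u' * v')"
    using assms(1) eq by (auto simp: ac_simps)
  then have uv: "u * v = u' * v'"
    using \<open>0 < s\<close> \<open>0 < t\<close> by simp
  \<comment> \<open>If \<open>u < u'\<close>, then \<open>v \<le> v'\<close> and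
    \<open>0 < v\<close> would make the products differ strictly.\<close>
  have "u = u'"
  proof (rule ccontr)
    assume "u \<noteq> u'"
    then have "u * v < u' * v'"
      using assms by (intro mult_less_le_imp_less) auto
    then show False
      using uv by simp
  qed
  then show "n = 1 \<and> u = u' \<and> v = v'"
    using n uv \<open>0 < u\<close> by simp
next
  assume "n = 1 \<and> u = u' \<and> v = v'"
  then show "s * v' * (u' * t) = p * q"
    using assms(1) by (simp add: ac_simps)
qed

theorem proposition5p2:
  fixes G :: "('a, 'b) monoid_scheme" (structure)
    and A B C :: "'a set"
  assumes "group G"
    and "finite_index_subgroup A G"
    and "finite_index_subgroup B G"
    and "finite_index_subgroup C G"
  shows "exp_double_Ruzsa G A C * exp_double_Ruzsa G C B = exp_double_Ruzsa G A B
    \<longleftrightarrow> A \<inter> B \<subseteq> C \<and> C = (C \<inter> A) <#> (C \<inter> B)"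
proof -
  interpret group G by fact
  have A: "subgroup A G" and B: "subgroup B G" and C: "subgroup C G"
    using assms by (simp_all add: finite_index_subgroup_def)
  have AB: "subgroup (A \<inter> B) G" and AC: "subgroup (A \<inter> C) G" and BC: "subgroup (B \<inter> C) G"
    using A B C by (simp_all add: subgroups_Inter_pair)
  let ?i = "relative_index G"
  \<comment> \<open>Both sides are the index of \<open>A \<inter> B \<inter> C\<close> in
    \<open>A\<close>, reached through \<open>A \<inter> B\<close> and through
    \<open>A \<inter> C\<close>.\<close>
  have "?i A B * ?i (A \<inter> B) C = ?i A C * ?i (A \<inter> C) B"
    using relative_index_Int[OF A B C] relative_index_Int[OF A C B] by (simp add: Int_commute)
  moreover have "?i B A * ?i (A \<inter> B) C = ?i B C * ?i (B \<inter> C) A"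
    using relative_index_Int[OF B A C] relative_index_Int[OF B C A] by (simp add: Int_commute)
  ultimately have "?i A B * ?i B A * (?i (A \<inter> B) C)\<^sup>2
      = ?i A C * ?i (A \<inter> C) B * (?i B C * ?i (B \<inter> C) A)"
    by (metis mult.assoc mult.left_commute power2_eq_square)
  then have "?i A C * ?i C A * (?i C B * ?i B C) = ?i A B * ?i B A \<longleftrightarrow>
      ?i (A \<inter> B) C = 1 \<and> ?i (A \<inter> C) B = ?i C B \<and> ?i (B \<inter> C) A = ?i C A"
    using assms A B C AB AC BC
    by (intro product_eq_iff_factors_eq) (auto intro: relative_index_mono relative_index_pos)
  then show ?thesis
    using exp_double_Ruzsa_eq[OF A C] exp_double_Ruzsa_eq[OF C B] exp_double_Ruzsa_eq[OF A B]
      relative_index_eq_1_iff[OF AB assms(4)] relative_index_Int_eq_iff[OF C assms(2) B]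
      relative_index_Int_eq_iff[OF C assms(3) A] eq_set_mult_Int_commute[OF A B C]
    by simp
qed

end
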